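(* Let $p_1=2<p_2=3<p_3=5<\cdots$ denote the sequence of prime numbers. For every $k\in\mathbb{N}$ ($k\ge 1$) and every complex $s$ with $\mathrm{Re}(s)>0$, $s\neq 1$, $$\zeta(s)=\left(\prod_{j=1}^{k}\frac{1}{1-p_j^{-s}}\right)\lim_{m\to\infty}\left[1+\sum_{\substack{p_{k+1}\le q\le p_{k+m}\\ q \text{ odd},\ q \text{ not divisible by any of } 3,5,7,\dots,p_k}} q^{-s}\;-\;\frac{p_{k+m}^{\,1-s}}{1-s}\prod_{j=1}^{k}\left(1-p_j^{-1}\right)\right],$$ where the sum runs over integers $q$ (thus over the primes larger than $p_k$ and all products of such primes, up to $p_{k+m}$).
   Context: $\zeta(s)$ is the Riemann zeta function (analytically continued). The list $3,5,7,\dots,p_k$ denotes the odd primes up to $p_k$; it is empty for $k=1$, in which case the sum runs over all odd $q$ with $p_2\le q\le p_{1+m}$. *)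

theory Defs
  imports
    "HOL-Complex_Analysis.Complex_Analysis"
    "HOL-Computational_Algebra.Primes"
    "HOL-Library.Infinite_Set"
begin

(* The Dirichlet series, indexed from 0 because suminf is. *)
definition zeta_series :: "complex \<Rightarrow> complex" where
  "zeta_series s = (\<Sum>n. of_nat (Suc n) powr (- s))"

definition continues_zeta :: "real \<Rightarrow> (complex \<Rightarrow> complex) \<Rightarrow> bool" where
  "continues_zeta c f \<longleftrightarrow>
     f holomorphic_on ({z. Re z > c} - {1}) \<and> (\<forall>z. Re z > 1 \<longrightarrow> f z = zeta_series z)"

(* The value at s of the analytic continuation of the Dirichlet series, taken along the
   half-planes Re z > c punctured at 1. These are connected and nested, so the value does not
   depend on c or f (zeta_eqI below); since every c < Re s is allowed, this is the Riemann zeta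
   function on all of the complex plane except 1. The value at s = 1 is unspecified. *)
definition zeta :: "complex \<Rightarrow> complex" where
  "zeta s = (THE w. \<exists>c f. c < Re s \<and> continues_zeta c f \<and> w = f s)"

(* The primes numbered from 1, as in p_1 = 2; the index 0 is not meaningful. *)
definition nth_prime :: "nat \<Rightarrow> nat" where
  "nth_prime k = enumerate {p. prime p} (k - 1)"

lemma continues_zeta_unique:
  assumes f: "continues_zeta c f" and g: "continues_zeta d g"
    and s: "c < Re s" "d < Re s" "s \<noteq> 1"
  shows "f s = g s"
proof -
  define e where "e = max c d"
  define H where "H = {z. Re z > e} - {1}"
  define U where "U = {z. Re z > max e 1}"
  have "open {z. Re z > e}"
    by (rule open_halfspace_Re_gt)
  moreover have "connected {z. Re z > e}"
    by (intro convex_connected convex_halfspace_Re_gt)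
  ultimately have H: "open H" "connected H"
    unfolding H_def by (auto intro!: open_delete connected_open_delete)
  have hf: "f holomorphic_on H" and hg: "g holomorphic_on H"
    using f g unfolding continues_zeta_def H_def e_def
    by (auto elim!: holomorphic_on_subset)
  have U: "open U" "U \<subseteq> H"
    using open_halfspace_Re_gt[of "max e 1"] unfolding U_def H_def by auto
  define x where "x = complex_of_real (max e 1 + 1)"
  have x: "x \<in> U"
    by (auto simp: U_def x_def max_def)
  show ?thesis
  proof (rule analytic_continuation_open[of U H f g])
    show "U \<noteq> {}" using x by blast
    show "f z = g z" if "z \<in> U" for z
      using that f g unfolding continues_zeta_def U_def by simp
    show "s \<in> H" using s by (simp add: H_def e_def)
  qed (use U H hf hg in auto)
qed

lemma zeta_eqI:
  assumes "continues_zeta c f" "c < Re s" "s \<noteq> 1"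
  shows "zeta s = f s"
  unfolding zeta_def using assms continues_zeta_unique by (intro the_equality) blast+

lemma zeta_eqI_UNIV:
  assumes "f holomorphic_on - {1}" "\<And>z. Re z > 1 \<Longrightarrow> f z = zeta_series z" "s \<noteq> 1"
  shows "zeta s = f s"
proof (rule zeta_eqI)
  show "continues_zeta (Re s - 1) f"
    using assms unfolding continues_zeta_def by (auto elim: holomorphic_on_subset)
qed (use assms in auto)

end

theory Submission
  imports Defs
begin

text \<open>
  For a finite set \<open>T\<close> of primes and real \<open>x > 0\<close>, let \<open>F\<^bsub>T\<^esub>(x)\<close> be the sum of
  \<open>n\<^bsup>-s\<^esup>\<close> over the positive integers \<open>n \<le> x\<close> that no prime in \<open>T\<close> divides, minus
  \<open>x\<^bsup>1-s\<^esup> / (1 - s) * (\<Prod>p\<in>T. 1 - 1/p)\<close>. Removing the multiples of one more prime \<open>p\<close>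
  from the sum subtracts \<open>p\<^bsup>-s\<^esup>\<close> times the same sum up to \<open>x / p\<close>. The second term obeys
  the same rule because \<open>p\<^bsup>-s\<^esup> * (x/p)\<^bsup>1-s\<^esup> = x\<^bsup>1-s\<^esup> / p\<close>. So
  \<open>F\<^bsub>T \<union> {p}\<^esub>(x) = F\<^bsub>T\<^esub>(x) - p\<^bsup>-s\<^esup> * F\<^bsub>T\<^esub>(x/p)\<close> holds exactly
  (\<open>sieved_sum_insert\<close>). As \<open>x\<close> and \<open>x / p\<close> tend to infinity together, each prime multiplies
  the limit by \<open>1 - p\<^bsup>-s\<^esup>\<close>, which is not zero for \<open>Re s > 0\<close>. The Dirichlet series itself
  need not converge at \<open>s\<close>, so the argument covers the critical strip.

  For the empty set, the limit is \<open>\<zeta>(s)\<close> (\<open>sieved_sum_empty_tendsto\<close>). Comparing \<open>n\<^bsup>-s\<^esup>\<close>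
  with the integral of \<open>t\<^bsup>-s\<^esup>\<close> over \<open>[n, n+1]\<close> leaves an error of order
  \<open>n\<^bsup>- Re s - 1\<^esup>\<close>, locally uniformly in \<open>s\<close>. So the limit exists and is
  holomorphic for \<open>Re s > 0\<close> away from \<open>1\<close>; for \<open>Re s > 1\<close> the power of \<open>x\<close> vanishes in the
  limit and the Dirichlet series remains.

  The theorem is the case where \<open>T\<close> consists of the first \<open>k\<close> primes and \<open>x\<close> runs through the
  later primes. An integer greater than \<open>1\<close> that is prime to \<open>T\<close> is at least the next
  prime, so the summation range of the theorem together with the term \<open>1\<close> is
  everything up to \<open>x\<close> that is prime to \<open>T\<close>.
\<close>

section \<open>Comparing the Dirichlet series with an integral\<close>

lemma norm_powr_diff_le:
  fixes a x y :: real and c :: complex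
  assumes "0 < a" "a \<le> x" "a \<le> y" "Re c \<le> 1"
  shows "norm (of_real x powr c - of_real y powr c)
           \<le> norm c * a powr (Re c - 1) * \<bar>x - y\<bar>"
proof -
  define S where "S = complex_of_real ` {a..}"
  have "convex S"
    unfolding S_def by (intro convex_linear_image linear_of_real) auto
  have "norm (complex_of_real x powr c - complex_of_real y powr c)
          \<le> norm c * a powr (Re c - 1) * norm (complex_of_real x - complex_of_real y)"
  proof (rule field_differentiable_bound[OF \<open>convex S\<close>,
            where f = "\<lambda>z. z powr c" and f' = "\<lambda>z. c * z powr (c - 1)"])
    fix z assume "z \<in> S"
    then obtain t where t: "z = of_real t" "t \<ge> a" by (auto simp: S_def)
    with assms have "t > 0" by simp
    then have "z \<notin> \<real>\<^sub>\<le>\<^sub>0" using t by auto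
    then show "((\<lambda>z. z powr c) has_field_derivative c * z powr (c - 1)) (at z within S)"
      by (auto intro!: derivative_eq_intros)
    have "norm (z powr (c - 1)) = t powr (Re c - 1)"
      using t \<open>t > 0\<close> by (subst norm_powr_real_powr) auto
    also have "\<dots> \<le> a powr (Re c - 1)"
      using assms t by (intro powr_mono2') auto
    finally show "norm (c * z powr (c - 1)) \<le> norm c * a powr (Re c - 1)"
      by (simp add: norm_mult mult_left_mono)
  qed (use assms in \<open>auto simp: S_def\<close>)
  then show ?thesis
    by (metis norm_of_real of_real_diff)
qed

text \<open>
  The term of the integer \<open>n + 1\<close> minus the integral of \<open>t\<^bsup>-s\<^esup>\<close> over \<open>[n + 1, n + 2]\<close>,
  with the integral written through its antiderivative.
\<close>

definition zeta_correction :: "nat \<Rightarrow> complex \<Rightarrow> complex" where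
  "zeta_correction n s = of_nat (Suc n) powr (- s)
     - (of_nat (Suc (Suc n)) powr (1 - s) - of_nat (Suc n) powr (1 - s)) / (1 - s)"

text \<open>
  The correction is the increment over \<open>[a, a+1]\<close>, \<open>a = n + 1\<close>, of a function with derivative
  \<open>a\<^bsup>-s\<^esup> - t\<^bsup>-s\<^esup>\<close>. Bounding that difference by \<open>norm_powr_diff_le\<close> gains the factor \<open>1 / a\<close>
  that makes the corrections summable for \<open>Re s > 0\<close>.
\<close>

lemma norm_zeta_correction_le:
  assumes "Re s > 0" "s \<noteq> 1"
  shows "norm (zeta_correction n s) \<le> norm s * real (Suc n) powr (- Re s - 1)"
proof -
  define a where "a = real (Suc n)"
  define S where "S = complex_of_real ` {a..a+1}"
  define h where "h = (\<lambda>z. z * complex_of_real a powr (- s) - z powr (1 - s) / (1 - s))"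
  define B where "B = norm s * a powr (- Re s - 1)"
  have "a > 0" by (simp add: a_def)
  have "convex S"
    unfolding S_def by (intro convex_linear_image linear_of_real) auto
  (* The derivative of h vanishes at a, so on an interval of length 1 it is at most B. *)
  have "norm (h (of_real (a + 1)) - h (of_real a))
          \<le> B * norm (complex_of_real (a + 1) - complex_of_real a)"
  proof (rule field_differentiable_bound[OF \<open>convex S\<close>,
            where f' = "\<lambda>z. of_real a powr (- s) - z powr (- s)"])
    fix z assume "z \<in> S"
    then obtain t where t: "z = of_real t" "t \<ge> a" "t \<le> a + 1" by (auto simp: S_def)
    have "z \<notin> \<real>\<^sub>\<le>\<^sub>0" using t \<open>a > 0\<close> by auto
    then show "(h has_field_derivative of_real a powr (- s) - z powr (- s)) (at z within S)"
      using assms unfolding h_def by (auto intro!: derivative_eq_intros)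
    have "norm (complex_of_real a powr (- s) - z powr (- s)) \<le> B * \<bar>a - t\<bar>"
      using norm_powr_diff_le[of a a t "- s"] assms t \<open>a > 0\<close> by (simp add: B_def)
    also have "\<dots> \<le> B * 1"
      using t by (intro mult_left_mono) (auto simp: B_def)
    finally show "norm (complex_of_real a powr (- s) - z powr (- s)) \<le> B" by simp
  qed (auto simp: S_def simp del: of_real_add)
  also have "h (of_real (a + 1)) - h (of_real a) = zeta_correction n s"
    by (simp add: h_def zeta_correction_def a_def algebra_simps diff_divide_distrib add_divide_distrib)
  finally show ?thesis by (simp add: B_def a_def)
qed

section \<open>The continuation of the zeta function to the right half-plane\<close>

text \<open>
  The power is taken at \<open>N + 1\<close>, one past the last term of the sum: the corrections then
  telescope to it exactly.
\<close>

definition zeta_approx :: "nat \<Rightarrow> complex \<Rightarrow> complex" where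
  "zeta_approx N s = (\<Sum>n<N. of_nat (Suc n) powr (- s)) - of_nat (Suc N) powr (1 - s) / (1 - s)"

lemma zeta_approx_eq_sum_correction:
  "zeta_approx N s = (\<Sum>n<N. zeta_correction n s) - 1 / (1 - s)"
proof (induction N)
  case (Suc N)
  have "zeta_approx (Suc N) s = zeta_approx N s + zeta_correction N s"
    by (simp add: zeta_approx_def zeta_correction_def diff_divide_distrib del: of_nat_Suc)
  then show ?case by (simp only: Suc sum.lessThan_Suc) simp
qed (simp add: zeta_approx_def)

text \<open>
  On a closed disc inside the half-plane, \<open>Re z\<close> is bounded below by a positive number, so one
  convergent series majorises all the corrections.
\<close>

lemma uniform_limit_zeta_approx:
  assumes "Re x > d" "d > 0" "1 \<notin> cball x d"
  shows "\<exists>l. uniform_limit (cball x d) zeta_approx l sequentially"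
proof -
  define M where "M = (\<lambda>n. (norm x + d) * real (Suc n) powr (- (Re x - d) - 1))"
  have "summable (\<lambda>n. real n powr (- (Re x - d) - 1))"
    using assms by (subst summable_real_powr_iff) auto
  then have "summable M"
    unfolding M_def by (intro summable_mult) (subst summable_Suc_iff)
  have bound: "norm (zeta_correction n z) \<le> M n" if "z \<in> cball x d" for n z
  proof -
    have xz: "norm (x - z) \<le> d" using that by (simp add: dist_norm)
    have "Re x - Re z \<le> d" using complex_Re_le_cmod[of "x - z"] xz by simp
    moreover have "norm z \<le> norm x + d"
      using norm_triangle_ineq2[of z x] xz by (simp add: norm_minus_commute)
    moreover have "z \<noteq> 1" using that assms by auto
    ultimately have "norm (zeta_correction n z) \<le> norm z * real (Suc n) powr (- Re z - 1)"
      using assms by (intro norm_zeta_correction_le) auto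
    also have "\<dots> \<le> M n"
      unfolding M_def using \<open>Re x - Re z \<le> d\<close> \<open>norm z \<le> norm x + d\<close> assms
      by (intro mult_mono powr_mono) auto
    finally show ?thesis .
  qed
  have "uniform_limit (cball x d) (\<lambda>N z. \<Sum>n<N. zeta_correction n z)
          (\<lambda>z. \<Sum>n. zeta_correction n z) sequentially"
    by (rule Weierstrass_m_test[OF _ \<open>summable M\<close>]) (use bound in auto)
  then have "uniform_limit (cball x d) (\<lambda>N z. (\<Sum>n<N. zeta_correction n z) - 1 / (1 - z))
          (\<lambda>z. (\<Sum>n. zeta_correction n z) - 1 / (1 - z)) sequentially"
    by (intro uniform_limit_intros)
  then show ?thesis
    by (auto simp: zeta_approx_eq_sum_correction[abs_def])
qed

lemma norm_of_nat_powr: "norm (complex_of_nat n powr c) = real n powr Re c"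
  by (subst norm_powr_real_powr) auto

lemma of_nat_powr_tendsto_0:
  assumes "Re c < 0"
  shows "(\<lambda>N. complex_of_nat (Suc N) powr c) \<longlonglongrightarrow> 0"
proof (rule tendsto_norm_zero_cancel)
  have "(\<lambda>N. real (Suc N) powr Re c) \<longlonglongrightarrow> 0"
    using assms
    by (intro tendsto_neg_powr filterlim_compose[OF filterlim_real_sequentially filterlim_Suc])
  then show "(\<lambda>N. norm (complex_of_nat (Suc N) powr c)) \<longlonglongrightarrow> 0"
    unfolding norm_of_nat_powr .
qed

lemma zeta_approx_tendsto_zeta:
  assumes "Re s > 0" "s \<noteq> 1"
  shows "(\<lambda>N. zeta_approx N s) \<longlonglongrightarrow> zeta s"
proof -
  define U where "U = {z. Re z > 0} - {1::complex}"
  define f where "f = (\<lambda>z. lim (\<lambda>N. zeta_approx N z))"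
  have "open U"
    unfolding U_def by (intro open_delete open_halfspace_Re_gt)
  have local_uniform:
    "\<exists>d>0. cball x d \<subseteq> U \<and> uniform_limit (cball x d) zeta_approx f sequentially"
    if "x \<in> U" for x
  proof -
    obtain d where d: "d > 0" "cball x d \<subseteq> U"
      using \<open>open U\<close> \<open>x \<in> U\<close> open_contains_cball by blast
    (* The leftmost point of the disc lies in the half-plane. *)
    have "x - of_real d \<in> cball x d" using d by (simp add: dist_norm)
    then have "x - of_real d \<in> U" by (rule subsetD[OF d(2)])
    then have "Re (x - of_real d) > 0" by (auto simp: U_def simp del: minus_complex.simps)
    then have "Re x > d" by simp
    moreover have "1 \<notin> cball x d" using d by (auto simp: U_def)
    ultimately obtain l where l: "uniform_limit (cball x d) zeta_approx l sequentially"
      using uniform_limit_zeta_approx d by blast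
    have "l z = f z" if "z \<in> cball x d" for z
      unfolding f_def using limI[OF tendsto_uniform_limitI[OF l that]] by simp
    then have "uniform_limit (cball x d) zeta_approx f sequentially"
      using iffD1[OF uniform_limit_cong'[OF refl] l] by blast
    with d show ?thesis by blast
  qed
  have "zeta_approx N holomorphic_on U" for N
    unfolding zeta_approx_def U_def by (intro holomorphic_intros) auto
  then have "f holomorphic_on U"
    by (rule holomorphic_uniform_sequence[OF \<open>open U\<close> _ local_uniform])
  moreover have "f z = zeta_series z" if "Re z > 1" for z
  proof -
    have "summable (\<lambda>n. real n powr (- Re z))"
      unfolding summable_real_powr_iff using that by simp
    then have "summable (\<lambda>n. real (Suc n) powr (- Re z))"
      by (rule iffD2[OF summable_Suc_iff])
    then have "summable (\<lambda>n. norm (complex_of_nat (Suc n) powr (- z)))"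
      unfolding norm_of_nat_powr by simp
    then have series: "(\<lambda>N. \<Sum>n<N. complex_of_nat (Suc n) powr (- z)) \<longlonglongrightarrow> zeta_series z"
      unfolding zeta_series_def by (rule summable_LIMSEQ[OF summable_norm_cancel])
    have power: "(\<lambda>N. complex_of_nat (Suc N) powr (1 - z)) \<longlonglongrightarrow> 0"
      by (rule of_nat_powr_tendsto_0) (use that in simp)
    have "1 - z \<noteq> 0" using that by auto
    then have "(\<lambda>N. zeta_approx N z) \<longlonglongrightarrow> zeta_series z - 0 / (1 - z)"
      unfolding zeta_approx_def by (rule tendsto_diff[OF series tendsto_divide[OF power tendsto_const]])
    then have "lim (\<lambda>N. zeta_approx N z) = zeta_series z - 0 / (1 - z)" by (rule limI)
    then show ?thesis by (simp add: f_def)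
  qed
  ultimately have "continues_zeta 0 f"
    unfolding continues_zeta_def U_def by simp
  then have "zeta s = f s"
    using assms by (intro zeta_eqI) auto
  moreover have "s \<in> U" using assms by (simp add: U_def)
  then obtain d where "d > 0" "uniform_limit (cball s d) zeta_approx f sequentially"
    using local_uniform by blast
  then have "(\<lambda>N. zeta_approx N s) \<longlonglongrightarrow> f s"
    using \<open>d > 0\<close> by (auto intro: tendsto_uniform_limitI)
  ultimately show ?thesis by simp
qed

section \<open>Sieving by a finite set of primes\<close>

text \<open>
  The cut-off is a real number so that dividing it by a prime stays within the definition.
\<close>

definition sieved_sum :: "complex \<Rightarrow> nat set \<Rightarrow> real \<Rightarrow> complex" where
  "sieved_sum s T x =
     (\<Sum>n | 0 < n \<and> real n \<le> x \<and> (\<forall>p\<in>T. \<not> p dvd n). of_nat n powr (- s))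
     - of_real x powr (1 - s) / (1 - s) * (\<Prod>p\<in>T. 1 - inverse (of_nat p))"

text \<open>
  Between consecutive integers the sum is constant, and \<open>x\<^bsup>1-s\<^esup>\<close> moves by at most a
  constant times \<open>\<lfloor>x\<rfloor>\<^bsup>- Re s\<^esup>\<close>; so the limit along the integers is the limit along
  the reals.
\<close>

lemma sieved_sum_empty_tendsto:
  assumes "Re s > 0" "s \<noteq> 1"
  shows "(sieved_sum s {} \<longlongrightarrow> zeta s) at_top"
proof -
  define N where "N = (\<lambda>x::real. nat \<lfloor>x\<rfloor>)"
  define r where "r = (\<lambda>x. (of_nat (Suc (N x)) powr (1 - s) - of_real x powr (1 - s)) / (1 - s))"
  have N: "filterlim N sequentially at_top"
    unfolding N_def by (intro filterlim_compose[OF filterlim_nat_sequentially filterlim_floor_sequentially])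
  have eq: "sieved_sum s {} x = zeta_approx (N x) s + r x" for x
  proof -
    have "real n \<le> x" if "n > 0" "n \<le> nat \<lfloor>x\<rfloor>" for n
      using that by linarith
    then have "{n. 0 < n \<and> real n \<le> x \<and> (\<forall>p\<in>{}. \<not> p dvd n)} = Suc ` {..<N x}"
      unfolding N_def image_Suc_lessThan by (auto simp: Suc_le_eq le_nat_floor)
    then show ?thesis
      by (simp add: sieved_sum_def zeta_approx_def r_def sum.reindex diff_divide_distrib)
  qed
  have "((\<lambda>x. real (N x) powr (- Re s)) \<longlongrightarrow> 0) at_top"
    using assms
    by (intro tendsto_neg_powr filterlim_compose[OF filterlim_real_sequentially N]) auto
  moreover have "\<forall>\<^sub>F x in at_top. norm (r x) \<le> real (N x) powr (- Re s)"
    using eventually_ge_at_top[of "1::real"]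
  proof eventually_elim
    case (elim x)
    have N_le: "real (N x) \<le> x" "x \<le> real (Suc (N x))" "0 < real (N x)"
      using elim by (auto simp: N_def) linarith+
    have "norm (of_real (real (Suc (N x))) powr (1 - s) - of_real x powr (1 - s))
            \<le> norm (1 - s) * real (N x) powr (Re (1 - s) - 1) * \<bar>real (Suc (N x)) - x\<bar>"
      using N_le assms by (intro norm_powr_diff_le) auto
    also have "\<dots> \<le> norm (1 - s) * real (N x) powr (Re (1 - s) - 1) * 1"
      using N_le by (intro mult_left_mono) auto
    finally show ?case
      using assms by (simp add: r_def norm_divide divide_le_eq mult.commute)
  qed
  ultimately have "(r \<longlongrightarrow> 0) at_top"
    by (rule Lim_null_comparison[rotated])
  moreover have "((\<lambda>x. zeta_approx (N x) s) \<longlongrightarrow> zeta s) at_top"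
    by (rule filterlim_compose[OF zeta_approx_tendsto_zeta[OF assms] N])
  ultimately show ?thesis
    unfolding eq[abs_def] using tendsto_add[of _ "zeta s" at_top r 0] by simp
qed

text \<open>
  The integers removed by \<open>p\<close> are \<open>p * n\<close> with \<open>n \<le> x / p\<close> and, since the other primes do not
  divide \<open>p\<close>, with \<open>n\<close> itself in the old sieved set.
\<close>

lemma sieved_sum_insert:
  assumes "finite T" "\<And>q. q \<in> T \<Longrightarrow> prime q" "prime p" "p \<notin> T" "x > 0"
  shows "sieved_sum s (insert p T) x = sieved_sum s T x - of_nat p powr (- s) * sieved_sum s T (x / real p)"
proof -
  define A where "A = (\<lambda>y. {n. 0 < n \<and> real n \<le> y \<and> (\<forall>q\<in>T. \<not> q dvd n)})"
  define g where "g = (\<lambda>n::nat. complex_of_nat n powr (- s))"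
  have "p > 0" using assms prime_gt_0_nat by blast
  have fin: "finite (A y)" for y
    by (rule finite_subset[of _ "{..nat \<lfloor>y\<rfloor>}"]) (auto simp: A_def le_nat_floor)
  have dvd: "q dvd p * n \<longleftrightarrow> q dvd n" if "q \<in> T" for q n
    using that assms primes_dvd_imp_eq[of q p] by (auto simp: prime_dvd_mult_iff)
  have mults: "{n \<in> A x. p dvd n} = (\<lambda>n. p * n) ` A (x / real p)"
  proof (intro equalityI subsetI)
    fix n assume "n \<in> {n \<in> A x. p dvd n}"
    then obtain m where m: "n = p * m" "n \<in> A x" by (auto elim: dvdE)
    then have "m \<in> A (x / real p)"
      using \<open>p > 0\<close> dvd by (simp add: A_def pos_le_divide_eq mult.commute)
    with m show "n \<in> (\<lambda>n. p * n) ` A (x / real p)" by blast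
  next
    fix n assume "n \<in> (\<lambda>n. p * n) ` A (x / real p)"
    then obtain m where "n = p * m" "m \<in> A (x / real p)" by blast
    then show "n \<in> {n \<in> A x. p dvd n}"
      using \<open>p > 0\<close> dvd by (simp add: A_def pos_le_divide_eq) (simp add: mult.commute)
  qed
  have "sum g (A x) = sum g {n \<in> A x. \<not> p dvd n} + sum g {n \<in> A x. p dvd n}"
    by (subst sum.union_disjoint[symmetric]) (auto intro!: sum.cong finite_subset[OF _ fin])
  also have "{n \<in> A x. \<not> p dvd n} = {n. 0 < n \<and> real n \<le> x \<and> (\<forall>q\<in>insert p T. \<not> q dvd n)}"
    by (auto simp: A_def)
  also have "sum g {n \<in> A x. p dvd n} = (\<Sum>n\<in>A (x / real p). g (p * n))"
    unfolding mults using \<open>p > 0\<close> by (subst sum.reindex) (auto simp: inj_on_def)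
  also have "\<dots> = of_nat p powr (- s) * sum g (A (x / real p))"
    unfolding g_def sum_distrib_left by (intro sum.cong) (auto simp: powr_times_real)
  finally have sums: "sum g {n. 0 < n \<and> real n \<le> x \<and> (\<forall>q\<in>insert p T. \<not> q dvd n)}
      = sum g (A x) - of_nat p powr (- s) * sum g (A (x / real p))"
    by simp
  have power: "of_nat p powr (- s) * of_real (x / real p) powr (1 - s)
      = of_real x powr (1 - s) * inverse (of_nat p)"
  proof -
    have "complex_of_real x powr (1 - s) = (of_real (real p) * of_real (x / real p)) powr (1 - s)"
      using \<open>p > 0\<close> by simp
    also have "\<dots> = of_nat p powr (1 - s) * of_real (x / real p) powr (1 - s)"
      using \<open>x > 0\<close> by (subst powr_times_real) auto
    also have "complex_of_nat p powr (1 - s) = of_nat p powr (- s) * of_nat p"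
      using \<open>p > 0\<close> powr_add[of "complex_of_nat p" "- s" 1] by simp
    finally show ?thesis using \<open>p > 0\<close> by (simp add: field_simps)
  qed
  show ?thesis
    unfolding sieved_sum_def using sums power assms
    by (simp add: A_def g_def algebra_simps diff_divide_distrib)
qed

lemma sieved_sum_tendsto:
  assumes "finite T" "\<And>p. p \<in> T \<Longrightarrow> prime p" "Re s > 0" "s \<noteq> 1"
  shows "(sieved_sum s T \<longlongrightarrow> zeta s * (\<Prod>p\<in>T. 1 - of_nat p powr (- s))) at_top"
  using assms(1,2)
proof (induction T rule: finite_induct)
  case empty
  then show ?case using sieved_sum_empty_tendsto assms by simp
next
  case (insert p T)
  define l where "l = zeta s * (\<Prod>p\<in>T. 1 - of_nat p powr (- s))"
  have lim: "(sieved_sum s T \<longlongrightarrow> l) at_top"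
    unfolding l_def using insert by blast
  have "prime p" using insert.prems by blast
  then have "p > 0" by (rule prime_gt_0_nat)
  then have "filterlim (\<lambda>x. inverse (real p) * x) at_top at_top"
    by (intro filterlim_tendsto_pos_mult_at_top[OF tendsto_const _ filterlim_ident]) simp
  then have "filterlim (\<lambda>x. x / real p) at_top at_top"
    by (simp only: divide_inverse mult.commute)
  then have lim_div: "((\<lambda>x. sieved_sum s T (x / real p)) \<longlongrightarrow> l) at_top"
    by (rule filterlim_compose[OF lim])
  have "((\<lambda>x. sieved_sum s T x - of_nat p powr (- s) * sieved_sum s T (x / real p))
      \<longlongrightarrow> l - of_nat p powr (- s) * l) at_top"
    by (rule tendsto_diff[OF lim tendsto_mult_left[OF lim_div]])
  moreover have "\<forall>\<^sub>F x in at_top. sieved_sum s T x - of_nat p powr (- s) * sieved_sum s T (x / real p)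
      = sieved_sum s (insert p T) x"
    using eventually_gt_at_top[of "0::real"]
    by eventually_elim (use insert \<open>prime p\<close> in \<open>simp add: sieved_sum_insert\<close>)
  ultimately have "(sieved_sum s (insert p T) \<longlongrightarrow> l - of_nat p powr (- s) * l) at_top"
    by (rule Lim_transform_eventually)
  also have "l - of_nat p powr (- s) * l = zeta s * (\<Prod>q\<in>insert p T. 1 - of_nat q powr (- s))"
    using insert.hyps by (simp add: l_def algebra_simps)
  finally show ?case .
qed

section \<open>The sequence of primes\<close>

lemma prime_nth_prime: "prime (nth_prime j)"
  using enumerate_in_set[OF primes_infinite] by (simp add: nth_prime_def)

lemma nth_prime_1: "nth_prime 1 = 2"
  unfolding nth_prime_def by (auto simp: enumerate_0 intro!: Least_equality two_is_prime_nat prime_ge_2_nat)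

lemma nth_prime_mono: "i \<le> j \<Longrightarrow> nth_prime i \<le> nth_prime j"
  unfolding nth_prime_def by (intro enumerate_mono_le_iff[OF primes_infinite, THEN iffD2]) simp

lemma inj_on_nth_prime: "inj_on nth_prime {1..}"
proof (rule inj_onI)
  fix i j assume "i \<in> {1..}" "j \<in> {1..}" "nth_prime i = nth_prime j"
  then show "i = j"
    using inj_enumerate[OF primes_infinite] unfolding nth_prime_def by (auto dest!: injD)
qed

lemma prime_obtain_nth_prime:
  assumes "prime r"
  obtains j where "j \<ge> 1" "r = nth_prime j"
proof -
  obtain n where "enumerate {p. prime p} n = r"
    using enumerate_Ex[OF primes_infinite, of r] assms by auto
  then show thesis by (intro that[of "Suc n"]) (auto simp: nth_prime_def)
qed

text \<open>Every prime factor of such an \<open>n\<close> comes after the first \<open>k\<close> primes.\<close>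

lemma nth_prime_le_if_coprime_to_initial_primes:
  assumes "n > 1" "\<And>j. j \<in> {1..k} \<Longrightarrow> \<not> nth_prime j dvd n"
  shows "nth_prime (k + 1) \<le> n"
proof -
  obtain r where r: "prime r" "r dvd n" using prime_factor_nat[of n] assms by auto
  then obtain j where j: "j \<ge> 1" "r = nth_prime j" using prime_obtain_nth_prime by blast
  with r assms(2)[of j] have "k + 1 \<le> j" by force
  then have "nth_prime (k + 1) \<le> r" using nth_prime_mono j by blast
  also have "r \<le> n" using r assms(1) by (intro dvd_imp_le) auto
  finally show ?thesis .
qed

lemma filterlim_nth_prime: "filterlim (\<lambda>m. real (nth_prime (k + m))) at_top sequentially"
proof (rule filterlim_compose[OF filterlim_real_sequentially])
  have "m \<le> nth_prime (k + Suc m)" for m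
    using le_enumerate[OF primes_infinite, of "k + m"] by (simp add: nth_prime_def)
  then have "filterlim (\<lambda>m. nth_prime (k + Suc m)) at_top sequentially"
    by (intro filterlim_at_top_mono[OF filterlim_ident]) auto
  then show "filterlim (\<lambda>m. nth_prime (k + m)) at_top sequentially"
    by (subst (asm) filterlim_sequentially_Suc)
qed

section \<open>The product formula\<close>

lemma one_minus_prime_powr_nonzero:
  assumes "Re s > 0" "prime p"
  shows "1 - complex_of_nat p powr (- s) \<noteq> 0"
proof
  assume "1 - complex_of_nat p powr (- s) = 0"
  then have "norm (complex_of_nat p powr (- s)) = 1" by simp
  then have "real p powr (- Re s) = 1" by (simp add: norm_of_nat_powr)
  moreover have "real p powr (- Re s) < real p powr 0"
    using assms prime_gt_1_nat[of p] by (intro powr_less_mono) auto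
  moreover have "p > 0" using assms prime_gt_0_nat by blast
  ultimately show False by simp
qed

theorem theorem1p3:
  fixes k :: nat and s :: complex
  assumes "k \<ge> 1" and "Re s > 0" and "s \<noteq> 1"
  shows "\<exists>L. (\<lambda>m. 1
                + (\<Sum>q | nth_prime (k + 1) \<le> q \<and> q \<le> nth_prime (k + m) \<and> odd q \<and>
                          (\<forall>j\<in>{2..k}. \<not> nth_prime j dvd q).
                     of_nat q powr (- s))
                - of_nat (nth_prime (k + m)) powr (1 - s) / (1 - s)
                  * (\<Prod>j=1..k. 1 - inverse (of_nat (nth_prime j))))
              \<longlonglongrightarrow> L
            \<and> zeta s = (\<Prod>j=1..k. 1 / (1 - of_nat (nth_prime j) powr (- s))) * L"
proof -
  define T where "T = nth_prime ` {1..k}"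
  define L where "L = zeta s * (\<Prod>p\<in>T. 1 - of_nat p powr (- s))"
  have inj: "inj_on nth_prime {1..k}"
    by (rule inj_on_subset[OF inj_on_nth_prime]) auto
  have "finite T" "\<And>p. p \<in> T \<Longrightarrow> prime p"
    by (auto simp: T_def prime_nth_prime)
  then have "(sieved_sum s T \<longlongrightarrow> L) at_top"
    unfolding L_def by (rule sieved_sum_tendsto) (use assms in auto)
  then have lim: "(\<lambda>m. sieved_sum s T (real (nth_prime (k + m)))) \<longlonglongrightarrow> L"
    by (rule filterlim_compose[OF _ filterlim_nth_prime])
  have "sieved_sum s T (real (nth_prime (k + m)))
          = 1 + (\<Sum>q | nth_prime (k + 1) \<le> q \<and> q \<le> nth_prime (k + m) \<and> odd q \<and>
                          (\<forall>j\<in>{2..k}. \<not> nth_prime j dvd q). of_nat q powr (- s))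
              - of_nat (nth_prime (k + m)) powr (1 - s) / (1 - s)
                  * (\<Prod>j=1..k. 1 - inverse (of_nat (nth_prime j)))" for m
  proof -
    define Q where "Q = {q. nth_prime (k + 1) \<le> q \<and> q \<le> nth_prime (k + m) \<and> odd q \<and>
                          (\<forall>j\<in>{2..k}. \<not> nth_prime j dvd q)}"
    have split: "{1..k} = insert 1 {2..k}" using assms(1) by auto
    have T_iff: "(\<forall>p\<in>T. \<not> p dvd n) \<longleftrightarrow> odd n \<and> (\<forall>j\<in>{2..k}. \<not> nth_prime j dvd n)" for n
      unfolding T_def split image_insert nth_prime_1 by simp
    have not_dvd_1: "\<not> nth_prime j dvd 1" for j
      using prime_nth_prime[of j] by auto
    have pos: "nth_prime j > 1" for j
      using prime_nth_prime prime_gt_1_nat by blast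
    have "{n. 0 < n \<and> real n \<le> real (nth_prime (k + m)) \<and> (\<forall>p\<in>T. \<not> p dvd n)} = insert 1 Q"
    proof (intro equalityI subsetI)
      fix n assume n: "n \<in> {n. 0 < n \<and> real n \<le> real (nth_prime (k + m)) \<and> (\<forall>p\<in>T. \<not> p dvd n)}"
      then have "nth_prime (k + 1) \<le> n" if "n > 1"
        using that by (intro nth_prime_le_if_coprime_to_initial_primes) (auto simp: T_def)
      with n show "n \<in> insert 1 Q" by (cases "n = 1") (auto simp: Q_def T_iff)
    next
      fix n assume "n \<in> insert 1 Q"
      then show "n \<in> {n. 0 < n \<and> real n \<le> real (nth_prime (k + m)) \<and> (\<forall>p\<in>T. \<not> p dvd n)}"
        using not_dvd_1 pos[of "k + m"] pos[of "k + 1"] by (auto simp: Q_def T_iff)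
    qed
    moreover have "finite Q"
      by (rule finite_subset[of _ "{..nth_prime (k + m)}"]) (auto simp: Q_def)
    moreover have "1 \<notin> Q"
      using pos[of "k + 1"] by (auto simp: Q_def)
    moreover have "(\<Prod>p\<in>T. 1 - inverse (complex_of_nat p))
                     = (\<Prod>j=1..k. 1 - inverse (of_nat (nth_prime j)))"
      unfolding T_def by (subst prod.reindex[OF inj]) simp
    ultimately show ?thesis
      unfolding sieved_sum_def Q_def[symmetric] by simp
  qed
  with lim have "(\<lambda>m. 1 + (\<Sum>q | nth_prime (k + 1) \<le> q \<and> q \<le> nth_prime (k + m) \<and> odd q \<and>
                          (\<forall>j\<in>{2..k}. \<not> nth_prime j dvd q). of_nat q powr (- s))
              - of_nat (nth_prime (k + m)) powr (1 - s) / (1 - s)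
                  * (\<Prod>j=1..k. 1 - inverse (of_nat (nth_prime j)))) \<longlonglongrightarrow> L"
    by simp
  moreover have "zeta s = (\<Prod>j=1..k. 1 / (1 - of_nat (nth_prime j) powr (- s))) * L"
  proof -
    have "(\<Prod>p\<in>T. 1 - complex_of_nat p powr (- s)) = (\<Prod>j=1..k. 1 - of_nat (nth_prime j) powr (- s))"
      unfolding T_def by (subst prod.reindex[OF inj]) simp
    moreover have "(\<Prod>j=1..k. 1 - complex_of_nat (nth_prime j) powr (- s)) \<noteq> 0"
      using one_minus_prime_powr_nonzero[OF assms(2) prime_nth_prime] by simp
    ultimately show ?thesis
      by (simp add: L_def prod_dividef)
  qed
  ultimately show ?thesis by blast
qed

end
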